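(* Let $\delta=1$ (resp. $\delta=-1$), let $k_0,k_1,k_2\in\mathbb{R}\setminus\{0\}$, $k_3\in\mathbb{R}$, and let $q(u_x,v_x)$ be an arbitrary smooth function of $(u_x,v_x)$ such that $k_2q_{v_x}-k_1q_{u_x}\neq0$. Then the system $$u_{xt}=\delta\,\frac{q\,q_{v_x}+k_0^2k_1(k_1v_x+k_2u_x)}{k_2q_{v_x}-k_1q_{u_x}}(k_1v+k_2u+k_3),$$ $$v_{xt}=-\delta\,\frac{q\,q_{u_x}+k_0^2k_2(k_1v_x+k_2u_x)}{k_2q_{v_x}-k_1q_{u_x}}(k_1v+k_2u+k_3)$$ describes pseudospherical surfaces (resp. spherical surfaces), with associated functions $$f_{11}=\tfrac{\delta}{\nu}k_0(k_1v_x+k_2u_x),\quad f_{12}=0,\quad f_{21}=\tfrac1\nu q(u_x,v_x),\quad f_{22}=\nu,\quad f_{31}=0,\quad f_{32}=k_0(k_1v+k_2u+k_3),$$ where $\nu\neq0$ is a real parameter.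
   Context: $q_{u_x},q_{v_x}$ denote the partial derivatives of $q$ with respect to its first and second arguments. Definition. A system of PDEs for $u(x,t),v(x,t)$ describes pseudospherical surfaces (take $\delta=1$), resp. spherical surfaces (take $\delta=-1$), with associated functions $f_{ij}$, $1\le i\le 3$, $1\le j\le 2$, if the system is equivalent to (i.e. has exactly the same solutions $(u,v)$ as) the structure equations $d\omega_1=\omega_3\wedge\omega_2$, $d\omega_2=\omega_1\wedge\omega_3$, $d\omega_3=\delta\,\omega_1\wedge\omega_2$ of a surface with Gaussian curvature $K=-\delta$, where $\omega_i=f_{i1}dx+f_{i2}dt$ and $f_{ij}$ are evaluated on $u,v$ and their derivatives, with $\omega_1\wedge\omega_2\neq0$, i.e. $f_{11}f_{22}-f_{12}f_{21}\ne 0$, for generic solutions (on a suitable nonempty open set); i.e. $f_{11}f_{22}-f_{12}f_{21}$, as a function of $(u,u_x,v,v_x)$, is nonzero up to a set of measure zero. *)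

theory Defs
  imports "HOL-Analysis.Analysis"
begin

fun Ck_on :: "nat \<Rightarrow> 'a::euclidean_space set \<Rightarrow> ('a \<Rightarrow> real) \<Rightarrow> bool" where
  "Ck_on 0 S f \<longleftrightarrow> continuous_on S f"
| "Ck_on (Suc k) S f \<longleftrightarrow>
     (\<forall>x\<in>S. f differentiable (at x)) \<and> (\<forall>h. Ck_on k S (\<lambda>x. frechet_derivative f (at x) h))"

text \<open>Intended for open \<open>S\<close> only, since the derivatives are taken at \<open>at x\<close>.\<close>

definition smooth_on :: "'a::euclidean_space set \<Rightarrow> ('a \<Rightarrow> real) \<Rightarrow> bool" where
  "smooth_on S f \<longleftrightarrow> (\<forall>k. Ck_on k S f)"

text \<open>Partial derivatives with respect to the first and second argument. They serve both for
  functions of \<open>(x, t)\<close> and for \<open>q\<close>, a function of \<open>(u\<^sub>x, v\<^sub>x)\<close>.\<close>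

definition pd1 :: "(real \<times> real \<Rightarrow> real) \<Rightarrow> real \<times> real \<Rightarrow> real" where
  "pd1 g p = frechet_derivative g (at p) (1, 0)"

definition pd2 :: "(real \<times> real \<Rightarrow> real) \<Rightarrow> real \<times> real \<Rightarrow> real" where
  "pd2 g p = frechet_derivative g (at p) (0, 1)"

text \<open>A one-form on the \<open>(x, t)\<close>-plane is given by its coefficients of \<open>dx\<close> and \<open>dt\<close>, a two-form
  by its coefficient of \<open>dx \<and> dt\<close>.\<close>

type_synonym one_form = "real \<times> real \<Rightarrow> real \<times> real"
type_synonym two_form = "real \<times> real \<Rightarrow> real"

definition wedge :: "one_form \<Rightarrow> one_form \<Rightarrow> two_form" where
  "wedge \<alpha> \<beta> p = fst (\<alpha> p) * snd (\<beta> p) - snd (\<alpha> p) * fst (\<beta> p)"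

definition ext_d :: "one_form \<Rightarrow> two_form" where
  "ext_d \<alpha> p = pd1 (\<lambda>r. snd (\<alpha> r)) p - pd2 (\<lambda>r. fst (\<alpha> r)) p"

text \<open>The order of the jet coordinates is \<open>(u, u\<^sub>x, v, v\<^sub>x)\<close>.\<close>

type_synonym jet = "real \<times> real \<times> real \<times> real"

definition jet :: "(real \<times> real \<Rightarrow> real) \<Rightarrow> (real \<times> real \<Rightarrow> real) \<Rightarrow> real \<times> real \<Rightarrow> jet" where
  "jet u v p = (u p, pd1 u p, v p, pd1 v p)"

text \<open>The associated functions \<open>f\<^sub>i\<^sub>j\<close> are \<open>f i j\<close> with \<open>i \<in> {1, 2, 3}\<close> and \<open>j \<in> {1, 2}\<close>;
  other indices are irrelevant.\<close>

definition omega ::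
  "(nat \<Rightarrow> nat \<Rightarrow> jet \<Rightarrow> real) \<Rightarrow> (real \<times> real \<Rightarrow> real) \<Rightarrow> (real \<times> real \<Rightarrow> real) \<Rightarrow> nat \<Rightarrow> one_form"
  where "omega f u v i p = (f i 1 (jet u v p), f i 2 (jet u v p))"

definition structure_equations ::
  "real \<Rightarrow> (nat \<Rightarrow> nat \<Rightarrow> jet \<Rightarrow> real)
     \<Rightarrow> (real \<times> real \<Rightarrow> real) \<Rightarrow> (real \<times> real \<Rightarrow> real) \<Rightarrow> real \<times> real \<Rightarrow> bool" where
  "structure_equations \<delta> f u v p \<longleftrightarrow>
     (let \<omega> = omega f u v in
        ext_d (\<omega> 1) p = wedge (\<omega> 3) (\<omega> 2) p \<and>
        ext_d (\<omega> 2) p = wedge (\<omega> 1) (\<omega> 3) p \<and>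
        ext_d (\<omega> 3) p = \<delta> * wedge (\<omega> 1) (\<omega> 2) p)"

text \<open>A system of PDEs for \<open>(u, v)\<close> is a predicate \<open>E u v p\<close> saying that the equations hold at the
  point \<open>p = (x, t)\<close>. Its solutions on an open set \<open>\<Omega>\<close> are the smooth pairs that satisfy it at all
  points of \<open>\<Omega>\<close>; \<open>J\<close> is the domain of jets on which the system and the \<open>f\<^sub>i\<^sub>j\<close> are defined, and
  solutions take their jets there.\<close>

definition solution_on ::
  "jet set \<Rightarrow> ((real \<times> real \<Rightarrow> real) \<Rightarrow> (real \<times> real \<Rightarrow> real) \<Rightarrow> real \<times> real \<Rightarrow> bool)
     \<Rightarrow> (real \<times> real) set \<Rightarrow> (real \<times> real \<Rightarrow> real) \<Rightarrow> (real \<times> real \<Rightarrow> real) \<Rightarrow> bool" where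
  "solution_on J E \<Omega> u v \<longleftrightarrow>
     smooth_on \<Omega> u \<and> smooth_on \<Omega> v \<and> (\<forall>p\<in>\<Omega>. jet u v p \<in> J) \<and> (\<forall>p\<in>\<Omega>. E u v p)"

text \<open>The system \<open>E\<close> describes surfaces of Gaussian curvature \<open>K = - \<delta>\<close>: pseudospherical surfaces
  if \<open>\<delta> = 1\<close>, spherical surfaces if \<open>\<delta> = - 1\<close>. The last conjunct is the condition that
  \<open>\<omega>\<^sub>1 \<and> \<omega>\<^sub>2 \<noteq> 0\<close> generically: as a function of \<open>(u, u\<^sub>x, v, v\<^sub>x)\<close> its coefficient vanishes
  only on a set of measure zero.\<close>

definition describes_surfaces ::
  "real \<Rightarrow> jet set \<Rightarrow> ((real \<times> real \<Rightarrow> real) \<Rightarrow> (real \<times> real \<Rightarrow> real) \<Rightarrow> real \<times> real \<Rightarrow> bool)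
     \<Rightarrow> (nat \<Rightarrow> nat \<Rightarrow> jet \<Rightarrow> real) \<Rightarrow> bool" where
  "describes_surfaces \<delta> J E f \<longleftrightarrow>
     open J \<and> J \<noteq> {} \<and>
     (\<forall>i\<in>{1,2,3}. \<forall>j\<in>{1,2}. smooth_on J (f i j)) \<and>
     (\<forall>\<Omega> u v. open \<Omega> \<longrightarrow>
        (solution_on J E \<Omega> u v \<longleftrightarrow> solution_on J (structure_equations \<delta> f) \<Omega> u v)) \<and>
     negligible {z \<in> J. f 1 1 z * f 2 2 z - f 1 2 z * f 2 1 z = 0}"

definition describes_pseudospherical where
  "describes_pseudospherical = describes_surfaces 1"

definition describes_spherical where
  "describes_spherical = describes_surfaces (- 1)"

end

theory Submission
  imports Defs
begin

text \<open>
  Write \<open>M = k1 v\<^sub>x + k2 u\<^sub>x\<close> and \<open>L = k1 v + k2 u + k3\<close>, so that \<open>L\<^sub>x = M\<close>. With the given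
  coefficients the third structure equation is precisely this identity times \<open>k0\<close>, because
  \<open>\<delta>\<^sup>2 = 1\<close>. After cancellation of the nonzero factors \<open>k0 / \<nu>\<close> and \<open>1 / \<nu>\<close> the first two are
  \<open>k2 u\<^sub>x\<^sub>t + k1 v\<^sub>x\<^sub>t = \<delta> q L\<close> and, by the chain rule,
  \<open>q\<^sub>1 u\<^sub>x\<^sub>t + q\<^sub>2 v\<^sub>x\<^sub>t = - \<delta> k0\<^sup>2 M L\<close>, where \<open>q\<^sub>1, q\<^sub>2\<close> are the partial derivatives of \<open>q\<close>.
  This is a linear system for \<open>(u\<^sub>x\<^sub>t, v\<^sub>x\<^sub>t)\<close> with determinant \<open>k2 q\<^sub>2 - k1 q\<^sub>1 \<noteq> 0\<close>,
  and Cramer's rule turns it into the stated PDE system. The equivalence therefore holds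
  point by point, wherever \<open>u\<close>, \<open>v\<close>, \<open>u\<^sub>x\<close>, \<open>v\<^sub>x\<close> and \<open>q\<close> are differentiable
  (\<open>structure_equations_iff_pde\<close>).

  The coefficient of \<open>\<omega>\<^sub>1 \<and> \<omega>\<^sub>2\<close> is \<open>\<delta> k0 M\<close>, a nonzero linear form on the jet space, so it
  vanishes only on a hyperplane. The functions \<open>f\<^sub>i\<^sub>j\<close> are smooth because each is affine or a
  multiple of \<open>q\<close> composed with a linear projection.
\<close>

section \<open>Smooth functions\<close>

text \<open>Derivatives are computed below only at points of an open set. This lemma lets the formula
  found there replace \<open>frechet_derivative\<close>, whose values outside the set are unknown.\<close>

lemma Ck_on_cong:
  assumes "open S" and "\<And>x. x \<in> S \<Longrightarrow> f x = g x" and "Ck_on k S f"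
  shows "Ck_on k S g"
  using assms(2,3)
proof (induction k arbitrary: f g)
  case 0
  then show ?case using continuous_on_cong[of S S f g] by simp
next
  case (Suc k)
  have der: "(g has_derivative frechet_derivative f (at x)) (at x)" if "x \<in> S" for x
  proof -
    have "(f has_derivative frechet_derivative f (at x)) (at x)"
      using Suc.prems(2) that by (simp add: frechet_derivative_works)
    then show ?thesis
      using has_derivative_transform_within_open[OF _ \<open>open S\<close> that] Suc.prems(1) by blast
  qed
  have "Ck_on k S (\<lambda>x. frechet_derivative g (at x) h)" for h
  proof (rule Suc.IH)
    show "Ck_on k S (\<lambda>x. frechet_derivative f (at x) h)"
      using Suc.prems(2) by simp
  qed (simp add: frechet_derivative_at[OF der, symmetric])
  then show ?case using der by (auto simp: differentiable_def)
qed

lemma Ck_on_const: "Ck_on k S (\<lambda>x. c)"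
  by (induction k arbitrary: c) simp_all

lemma Ck_on_affine:
  assumes "bounded_linear L"
  shows "Ck_on k S (\<lambda>x. L x + c)"
proof (cases k)
  case 0
  then show ?thesis
    using assms by (auto intro!: continuous_intros simp: linear_continuous_on)
next
  case (Suc n)
  have der: "((\<lambda>x. L x + c) has_derivative L) (at x)" for x
    using assms by (auto intro!: derivative_eq_intros bounded_linear_imp_has_derivative)
  show ?thesis
    unfolding Suc using der
    by (auto simp: differentiable_def frechet_derivative_at[OF der, symmetric] Ck_on_const)
qed

lemma smooth_on_affine: "bounded_linear L \<Longrightarrow> smooth_on S (\<lambda>x. L x + c)"
  by (simp add: smooth_on_def Ck_on_affine)

text \<open>The induction goes through because the derivative of \<open>c * g (P z)\<close> in direction \<open>h\<close> is
  \<open>c * g' (P z)\<close> with \<open>g'\<close> the derivative of \<open>g\<close> in the constant direction \<open>P h\<close>: it has the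
  same form again.\<close>

lemma Ck_on_cmult_compose_linear:
  fixes P :: "'b::euclidean_space \<Rightarrow> 'a::euclidean_space"
  assumes P: "bounded_linear P" and "open S" and "Ck_on k S g"
  shows "Ck_on k (P -` S) (\<lambda>z. c * g (P z))"
  using assms(3)
proof (induction k arbitrary: g)
  case 0
  have "continuous_on (P -` S) P" using P by (simp add: linear_continuous_on)
  moreover have "continuous_on (P ` (P -` S)) g"
    using 0 by (auto intro: continuous_on_subset)
  ultimately show ?case
    by (auto intro!: continuous_intros intro: continuous_on_compose2)
next
  case (Suc k)
  have op: "open (P -` S)"
    using P \<open>open S\<close> by (simp add: continuous_open_vimage linear_continuous_at)
  have der: "((\<lambda>z. c * g (P z)) has_derivative
      (\<lambda>h. c * frechet_derivative g (at (P z)) (P h))) (at z)" if "z \<in> P -` S" for z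
  proof -
    have "(g has_derivative frechet_derivative g (at (P z))) (at (P z))"
      using Suc.prems that by (simp add: frechet_derivative_works)
    from has_derivative_compose[OF bounded_linear_imp_has_derivative[OF P] this]
    show ?thesis by (rule has_derivative_mult_right)
  qed
  have "Ck_on k (P -` S) (\<lambda>z. frechet_derivative (\<lambda>z. c * g (P z)) (at z) h)" for h
  proof (rule Ck_on_cong[OF op])
    show "Ck_on k (P -` S) (\<lambda>z. c * frechet_derivative g (at (P z)) (P h))"
      using Suc.prems by (intro Suc.IH) simp
  qed (simp add: frechet_derivative_at[OF der, symmetric])
  then show ?case using der by (auto simp: differentiable_def)
qed

lemma smooth_on_cmult_compose_linear:
  fixes P :: "'b::euclidean_space \<Rightarrow> 'a::euclidean_space"
  shows "bounded_linear P \<Longrightarrow> open S \<Longrightarrow> smooth_on S g \<Longrightarrow>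
    smooth_on (P -` S) (\<lambda>z. c * g (P z))"
  by (simp add: smooth_on_def Ck_on_cmult_compose_linear)

lemma smooth_on_differentiable:
  assumes "smooth_on S g" and "p \<in> S"
  shows "g differentiable (at p)" and "pd1 g differentiable (at p)"
proof -
  have "Ck_on (Suc (Suc 0)) S g" using assms(1) unfolding smooth_on_def by blast
  then have "g differentiable (at p) \<and> (\<lambda>x. frechet_derivative g (at x) (1, 0)) differentiable (at p)"
    using assms(2) by simp
  then show "g differentiable (at p)" and "pd1 g differentiable (at p)"
    by (simp_all add: pd1_def[abs_def])
qed

section \<open>Partial derivatives of the coefficients\<close>

lemma pd1_eqI: "(g has_derivative g') (at p) \<Longrightarrow> pd1 g p = g' (1, 0)"
  by (simp add: pd1_def frechet_derivative_at[symmetric])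

lemma pd2_eqI: "(g has_derivative g') (at p) \<Longrightarrow> pd2 g p = g' (0, 1)"
  by (simp add: pd2_def frechet_derivative_at[symmetric])

lemma pd1_const: "pd1 (\<lambda>r. c) p = 0" and pd2_const: "pd2 (\<lambda>r. c) p = 0"
  by (simp_all add: pd1_def pd2_def)

lemma pd_affine:
  assumes "g differentiable (at p)" and "h differentiable (at p)"
  shows "pd1 (\<lambda>r. c * (a * g r + b * h r + d)) p = c * (a * pd1 g p + b * pd1 h p)"
    and "pd2 (\<lambda>r. c * (a * g r + b * h r + d)) p = c * (a * pd2 g p + b * pd2 h p)"
proof -
  have der: "((\<lambda>r. c * (a * g r + b * h r + d)) has_derivative
      (\<lambda>y. c * (a * frechet_derivative g (at p) y + b * frechet_derivative h (at p) y))) (at p)"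
    using assms
    by (auto intro!: derivative_eq_intros simp: frechet_derivative_works)
  show "pd1 (\<lambda>r. c * (a * g r + b * h r + d)) p = c * (a * pd1 g p + b * pd1 h p)"
    by (simp add: pd1_eqI[OF der]) (simp add: pd1_def)
  show "pd2 (\<lambda>r. c * (a * g r + b * h r + d)) p = c * (a * pd2 g p + b * pd2 h p)"
    by (simp add: pd2_eqI[OF der]) (simp add: pd2_def)
qed

lemma pd2_chain:
  assumes g: "g differentiable (at p)" and h: "h differentiable (at p)"
    and q: "q differentiable (at (g p, h p))"
  shows "pd2 (\<lambda>r. c * q (g r, h r)) p =
    c * (pd1 q (g p, h p) * pd2 g p + pd2 q (g p, h p) * pd2 h p)"
proof -
  let ?q' = "frechet_derivative q (at (g p, h p))"
  have "((\<lambda>r. (g r, h r)) has_derivative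
      (\<lambda>y. (frechet_derivative g (at p) y, frechet_derivative h (at p) y))) (at p)"
    using g h by (auto intro!: has_derivative_Pair simp: frechet_derivative_works)
  moreover have q': "(q has_derivative ?q') (at (g p, h p))"
    using q by (simp add: frechet_derivative_works)
  ultimately have "((\<lambda>r. q (g r, h r)) has_derivative
      (\<lambda>y. ?q' (frechet_derivative g (at p) y, frechet_derivative h (at p) y))) (at p)"
    by (rule has_derivative_compose)
  then have "((\<lambda>r. c * q (g r, h r)) has_derivative
      (\<lambda>y. c * ?q' (frechet_derivative g (at p) y, frechet_derivative h (at p) y))) (at p)"
    by (rule has_derivative_mult_right)
  then have deriv: "pd2 (\<lambda>r. c * q (g r, h r)) p = c * ?q' (pd2 g p, pd2 h p)"
    by (simp add: pd2_eqI) (simp add: pd2_def)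
  have "?q' (a, b) = a * ?q' (1, 0) + b * ?q' (0, 1)" for a b
  proof -
    have lin: "linear ?q'" using q' by (rule has_derivative_linear)
    have "?q' (a, b) = ?q' (a *\<^sub>R (1, 0) + b *\<^sub>R (0, 1))" by simp
    then show ?thesis by (simp only: linear_add[OF lin] linear_cmul[OF lin] real_scaleR_def)
  qed
  then have "?q' (pd2 g p, pd2 h p) = pd1 q (g p, h p) * pd2 g p + pd2 q (g p, h p) * pd2 h p"
    by (metis pd1_def pd2_def mult.commute)
  with deriv show ?thesis by (simp only:)
qed

section \<open>Equivalence with the structure equations\<close>

lemma cramer_2x2:
  fixes a b :: "'a::field"
  assumes "d = a11 * a22 - a12 * a21" and "d \<noteq> 0"
  shows "a11 * a + a12 * b = r \<and> a21 * a + a22 * b = s \<longleftrightarrow>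
    a = (r * a22 - a12 * s) / d \<and> b = (a11 * s - r * a21) / d"
proof
  assume "a11 * a + a12 * b = r \<and> a21 * a + a22 * b = s"
  then have "a * d = r * a22 - a12 * s" and "b * d = a11 * s - r * a21"
    unfolding assms(1) by (auto simp: algebra_simps)
  then show "a = (r * a22 - a12 * s) / d \<and> b = (a11 * s - r * a21) / d"
    using assms(2) by (simp add: eq_divide_eq)
next
  assume *: "a = (r * a22 - a12 * s) / d \<and> b = (a11 * s - r * a21) / d"
  have "a11 * a + a12 * b = r * d / d" and "a21 * a + a22 * b = s * d / d"
    using * by (simp_all add: assms(1) add_divide_distrib[symmetric] algebra_simps)
  then show "a11 * a + a12 * b = r \<and> a21 * a + a22 * b = s"
    using assms(2) by simp
qed

lemma structure_equations_iff_pde: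
  fixes \<delta> k0 k1 k2 k3 \<nu> :: real and f :: "nat \<Rightarrow> nat \<Rightarrow> jet \<Rightarrow> real"
  assumes \<delta>: "\<delta> * \<delta> = 1" and k0: "k0 \<noteq> 0" and \<nu>: "\<nu> \<noteq> 0"
    and f: "f 1 1 = (\<lambda>(u, ux, v, vx). \<delta> / \<nu> * k0 * (k1 * vx + k2 * ux))"
      "f 1 2 = (\<lambda>(u, ux, v, vx). 0)"
      "f 2 1 = (\<lambda>(u, ux, v, vx). 1 / \<nu> * q (ux, vx))"
      "f 2 2 = (\<lambda>(u, ux, v, vx). \<nu>)"
      "f 3 1 = (\<lambda>(u, ux, v, vx). 0)"
      "f 3 2 = (\<lambda>(u, ux, v, vx). k0 * (k1 * v + k2 * u + k3))"
    and u: "u differentiable (at p)" "pd1 u differentiable (at p)"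
    and v: "v differentiable (at p)" "pd1 v differentiable (at p)"
    and w: "w = (pd1 u p, pd1 v p)"
    and q: "q differentiable (at w)"
    and D: "k2 * pd2 q w - k1 * pd1 q w \<noteq> 0"
  shows "structure_equations \<delta> f u v p \<longleftrightarrow>
    pd2 (pd1 u) p =
      \<delta> * ((q w * pd2 q w + k0\<^sup>2 * k1 * (k1 * pd1 v p + k2 * pd1 u p)) / (k2 * pd2 q w - k1 * pd1 q w))
        * (k1 * v p + k2 * u p + k3) \<and>
    pd2 (pd1 v) p =
      - \<delta> * ((q w * pd1 q w + k0\<^sup>2 * k2 * (k1 * pd1 v p + k2 * pd1 u p)) / (k2 * pd2 q w - k1 * pd1 q w))
        * (k1 * v p + k2 * u p + k3)"
    (is "_ \<longleftrightarrow> ?a = ?A \<and> ?b = ?B")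
proof -
  let ?L = "k1 * v p + k2 * u p + k3"
  let ?M = "k1 * pd1 v p + k2 * pd1 u p"
  let ?D = "k2 * pd2 q w - k1 * pd1 q w"
  have "pd2 (\<lambda>r. \<delta> / \<nu> * k0 * (k1 * pd1 v r + k2 * pd1 u r)) p = \<delta> / \<nu> * k0 * (k1 * ?b + k2 * ?a)"
    using pd_affine(2)[OF v(2) u(2), of "\<delta> / \<nu> * k0" k1 k2 0] by simp
  then have d1: "ext_d (omega f u v 1) p = - (\<delta> / \<nu> * k0 * (k1 * ?b + k2 * ?a))"
    unfolding ext_d_def omega_def jet_def f by (simp add: pd1_const)
  have "pd2 (\<lambda>r. 1 / \<nu> * q (pd1 u r, pd1 v r)) p = 1 / \<nu> * (pd1 q w * ?a + pd2 q w * ?b)"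
    using pd2_chain[OF u(2) v(2)] q w by blast
  then have d2: "ext_d (omega f u v 2) p = - (1 / \<nu> * (pd1 q w * ?a + pd2 q w * ?b))"
    unfolding ext_d_def omega_def jet_def f by (simp add: pd1_const)
  have d3: "ext_d (omega f u v 3) p = k0 * ?M"
    unfolding ext_d_def omega_def jet_def f using pd_affine(1)[OF v(1) u(1)] by (simp add: pd2_const)
  have "structure_equations \<delta> f u v p \<longleftrightarrow>
      - (\<delta> / \<nu> * k0 * (k1 * ?b + k2 * ?a)) = - (k0 * ?L * (1 / \<nu> * q w)) \<and>
      - (1 / \<nu> * (pd1 q w * ?a + pd2 q w * ?b)) = \<delta> / \<nu> * k0 * ?M * (k0 * ?L) \<and>
      k0 * ?M = \<delta> * (\<delta> / \<nu> * k0 * ?M * \<nu>)"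
    unfolding structure_equations_def Let_def d1 d2 d3
    unfolding wedge_def omega_def jet_def f by (simp add: w)
  also have "\<dots> \<longleftrightarrow> \<delta> * (k2 * ?a + k1 * ?b) = q w * ?L \<and>
      pd1 q w * ?a + pd2 q w * ?b = - (\<delta> * k0\<^sup>2 * ?M * ?L)"
  proof -
    have "- (\<delta> / \<nu> * k0 * (k1 * ?b + k2 * ?a)) = - (k0 * ?L * (1 / \<nu> * q w)) \<longleftrightarrow>
        (k0 / \<nu>) * (\<delta> * (k2 * ?a + k1 * ?b)) = (k0 / \<nu>) * (q w * ?L)"
      by (auto simp: algebra_simps)
    also have "\<dots> \<longleftrightarrow> \<delta> * (k2 * ?a + k1 * ?b) = q w * ?L"
      using k0 \<nu> by (intro mult_left_cancel) simp
    finally have first: "- (\<delta> / \<nu> * k0 * (k1 * ?b + k2 * ?a)) = - (k0 * ?L * (1 / \<nu> * q w)) \<longleftrightarrow>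
        \<delta> * (k2 * ?a + k1 * ?b) = q w * ?L" .
    have "- (1 / \<nu> * (pd1 q w * ?a + pd2 q w * ?b)) = \<delta> / \<nu> * k0 * ?M * (k0 * ?L) \<longleftrightarrow>
        (- 1 / \<nu>) * (pd1 q w * ?a + pd2 q w * ?b) = (- 1 / \<nu>) * (- (\<delta> * k0\<^sup>2 * ?M * ?L))"
      by (simp add: power2_eq_square mult.assoc mult.left_commute)
    also have "\<dots> \<longleftrightarrow> pd1 q w * ?a + pd2 q w * ?b = - (\<delta> * k0\<^sup>2 * ?M * ?L)"
      using \<nu> by (intro mult_left_cancel) simp
    finally have second: "- (1 / \<nu> * (pd1 q w * ?a + pd2 q w * ?b)) =
        \<delta> / \<nu> * k0 * ?M * (k0 * ?L) \<longleftrightarrow>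
        pd1 q w * ?a + pd2 q w * ?b = - (\<delta> * k0\<^sup>2 * ?M * ?L)" .
    have "\<delta> * (\<delta> / \<nu> * k0 * ?M * \<nu>) = (\<delta> * \<delta>) * (k0 * ?M)" using \<nu> by simp
    then have third: "k0 * ?M = \<delta> * (\<delta> / \<nu> * k0 * ?M * \<nu>)" using \<delta> by simp
    show ?thesis using first second third by blast
  qed
  also have "\<dots> \<longleftrightarrow> k2 * ?a + k1 * ?b = \<delta> * (q w * ?L) \<and>
      pd1 q w * ?a + pd2 q w * ?b = - (\<delta> * k0\<^sup>2 * ?M * ?L)"
  proof -
    \<comment> \<open>\<open>\<delta>\<close> is its own inverse, so it can change sides.\<close>
    have "\<delta> * x = y \<longleftrightarrow> x = \<delta> * y" for x y
      using \<delta> by (metis mult.assoc mult_1)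
    then show ?thesis by simp
  qed
  also have "\<dots> \<longleftrightarrow>
      ?a = (\<delta> * (q w * ?L) * pd2 q w - k1 * - (\<delta> * k0\<^sup>2 * ?M * ?L)) / ?D \<and>
      ?b = (k2 * - (\<delta> * k0\<^sup>2 * ?M * ?L) - \<delta> * (q w * ?L) * pd1 q w) / ?D"
    by (rule cramer_2x2[OF refl D])
  also have "(\<delta> * (q w * ?L) * pd2 q w - k1 * - (\<delta> * k0\<^sup>2 * ?M * ?L)) / ?D = ?A"
    by (simp add: algebra_simps)
  also have "(k2 * - (\<delta> * k0\<^sup>2 * ?M * ?L) - \<delta> * (q w * ?L) * pd1 q w) / ?D = ?B"
  proof -
    have "k2 * - (\<delta> * k0\<^sup>2 * ?M * ?L) - \<delta> * (q w * ?L) * pd1 q w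
        = - \<delta> * (q w * pd1 q w + k0\<^sup>2 * k2 * ?M) * ?L" by (simp add: algebra_simps)
    then show ?thesis by simp
  qed
  finally show ?thesis .
qed

theorem corollary5p8:
  fixes \<delta> k0 k1 k2 k3 \<nu> :: real
    and Q :: "(real \<times> real) set"
    and q :: "real \<times> real \<Rightarrow> real"
    and J :: "jet set"
    and f :: "nat \<Rightarrow> nat \<Rightarrow> jet \<Rightarrow> real"
    and E :: "(real \<times> real \<Rightarrow> real) \<Rightarrow> (real \<times> real \<Rightarrow> real) \<Rightarrow> real \<times> real \<Rightarrow> bool"
  assumes "\<delta> = 1 \<or> \<delta> = - 1"
    and "k0 \<noteq> 0" and "k1 \<noteq> 0" and "k2 \<noteq> 0" and "\<nu> \<noteq> 0"
    and "open Q" and "Q \<noteq> {}" and "smooth_on Q q"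
    and "\<forall>w\<in>Q. k2 * pd2 q w - k1 * pd1 q w \<noteq> 0"
    and J: "J = {(u, ux, v, vx). (ux, vx) \<in> Q}"
    and E: "\<And>u v p. E u v p \<longleftrightarrow>
      (let ux = pd1 u p; vx = pd1 v p; w = (ux, vx) in
        pd2 (pd1 u) p =
          \<delta> * ((q w * pd2 q w + k0\<^sup>2 * k1 * (k1 * vx + k2 * ux)) / (k2 * pd2 q w - k1 * pd1 q w))
            * (k1 * v p + k2 * u p + k3) \<and>
        pd2 (pd1 v) p =
          - \<delta> * ((q w * pd1 q w + k0\<^sup>2 * k2 * (k1 * vx + k2 * ux)) / (k2 * pd2 q w - k1 * pd1 q w))
            * (k1 * v p + k2 * u p + k3))"
    and "f 1 1 = (\<lambda>(u, ux, v, vx). \<delta> / \<nu> * k0 * (k1 * vx + k2 * ux))"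
    and "f 1 2 = (\<lambda>(u, ux, v, vx). 0)"
    and "f 2 1 = (\<lambda>(u, ux, v, vx). 1 / \<nu> * q (ux, vx))"
    and "f 2 2 = (\<lambda>(u, ux, v, vx). \<nu>)"
    and "f 3 1 = (\<lambda>(u, ux, v, vx). 0)"
    and "f 3 2 = (\<lambda>(u, ux, v, vx). k0 * (k1 * v + k2 * u + k3))"
  shows "(\<delta> = 1 \<longrightarrow> describes_pseudospherical J E f) \<and>
         (\<delta> = - 1 \<longrightarrow> describes_spherical J E f)"
proof -
  note f = assms(12-17)
  have \<delta>: "\<delta> * \<delta> = 1" using assms(1) by auto
  define P :: "jet \<Rightarrow> real \<times> real" where "P = (\<lambda>z. (fst (snd z), snd (snd (snd z))))"
  have P: "bounded_linear P"
    unfolding P_def by (intro bounded_linear_intros)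
  have JP: "J = P -` Q" by (auto simp: J P_def)
  have open_J: "open J"
    unfolding JP using P \<open>open Q\<close> by (simp add: continuous_open_vimage linear_continuous_at)
  have ne_J: "J \<noteq> {}" using \<open>Q \<noteq> {}\<close> by (auto simp: J)
  have smooth_f: "smooth_on J (f i j)" if "i \<in> {1, 2, 3}" "j \<in> {1, 2}" for i j
  proof -
    have const: "smooth_on J (\<lambda>z. c)" for c
      by (simp add: smooth_on_def Ck_on_const)
    have "f 1 1 = (\<lambda>z. \<delta> / \<nu> * k0 * (k1 * snd (snd (snd z)) + k2 * fst (snd z)) + 0)"
      unfolding f by auto
    moreover have "bounded_linear
        (\<lambda>z::jet. \<delta> / \<nu> * k0 * (k1 * snd (snd (snd z)) + k2 * fst (snd z)))"
      by (intro bounded_linear_intros)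
    ultimately have "smooth_on J (f 1 1)" by (simp only: smooth_on_affine)
    moreover have "f 3 2 = (\<lambda>z. k0 * (k1 * fst (snd (snd z)) + k2 * fst z) + k0 * k3)"
      unfolding f by (auto simp: algebra_simps)
    moreover have "bounded_linear (\<lambda>z::jet. k0 * (k1 * fst (snd (snd z)) + k2 * fst z))"
      by (intro bounded_linear_intros)
    ultimately have "smooth_on J (f 1 1)" and "smooth_on J (f 3 2)"
      by (simp_all only: smooth_on_affine)
    moreover have "smooth_on J (f 2 1)"
    proof -
      have "f 2 1 = (\<lambda>z. 1 / \<nu> * q (P z))" unfolding f P_def by auto
      then show ?thesis
        using smooth_on_cmult_compose_linear[OF P \<open>open Q\<close> \<open>smooth_on Q q\<close>] by (simp only: JP)
    qed
    moreover have "smooth_on J (f 1 2)" "smooth_on J (f 2 2)" "smooth_on J (f 3 1)"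
      unfolding f using const by (simp_all add: case_prod_unfold)
    ultimately show ?thesis using that by blast
  qed
  have equiv: "solution_on J E \<Omega> u v \<longleftrightarrow> solution_on J (structure_equations \<delta> f) \<Omega> u v" for \<Omega> u v
  proof -
    have "E u v p \<longleftrightarrow> structure_equations \<delta> f u v p"
      if "smooth_on \<Omega> u" "smooth_on \<Omega> v" "p \<in> \<Omega>" "jet u v p \<in> J" for p
    proof -
      have wQ: "(pd1 u p, pd1 v p) \<in> Q" using that(4) by (simp add: J jet_def)
      show ?thesis
        unfolding E Let_def
        using structure_equations_iff_pde[OF \<delta> \<open>k0 \<noteq> 0\<close> \<open>\<nu> \<noteq> 0\<close> f
            smooth_on_differentiable[OF that(1,3)] smooth_on_differentiable[OF that(2,3)] refl
            smooth_on_differentiable(1)[OF \<open>smooth_on Q q\<close> wQ]] assms(9) wQ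
        by blast
    qed
    then show ?thesis unfolding solution_on_def by blast
  qed
  have neg: "negligible {z \<in> J. f 1 1 z * f 2 2 z - f 1 2 z * f 2 1 z = 0}"
  proof (rule negligible_subset)
    show "negligible {z. (0, k2, 0, k1) \<bullet> z = (0::real)}"
      using \<open>k1 \<noteq> 0\<close> by (intro negligible_hyperplane) (simp add: zero_prod_def)
    show "{z \<in> J. f 1 1 z * f 2 2 z - f 1 2 z * f 2 1 z = 0} \<subseteq> {z. (0, k2, 0, k1) \<bullet> z = 0}"
      unfolding f using assms(1) \<open>k0 \<noteq> 0\<close> \<open>\<nu> \<noteq> 0\<close> by (auto simp: add.commute)
  qed
  have "describes_surfaces \<delta> J E f"
    unfolding describes_surfaces_def using open_J ne_J smooth_f equiv neg by blast
  then show ?thesis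
    by (auto simp: describes_pseudospherical_def describes_spherical_def)
qed

end
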